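(* For every $q\in\mathbb{N}$, the set $\mathscr{C}_q:=\{S \mid S \text{ is a numerical semigroup with } \operatorname{depth}(S)\le q\}$ is an arithmetic variety.
   Context: $\mathbb{N}$ denotes the set of non-negative integers. A numerical semigroup is a subset $S\subseteq\mathbb{N}$ containing $0$, closed under addition, with $\mathbb{N}\setminus S$ finite. Its multiplicity is $\operatorname{m}(S)=\min(S\setminus\{0\})$ and its Frobenius number is $\operatorname{F}(S)=\max(\mathbb{Z}\setminus S)$ (so $\operatorname{F}(\mathbb{N})=-1$). The depth of $S$, $\operatorname{depth}(S)$, is the integer $q$ such that $\operatorname{F}(S)+1=q\operatorname{m}(S)-r$ for some integer $0\le r<\operatorname{m}(S)$; equivalently $\operatorname{depth}(S)=\left\lceil\frac{\operatorname{F}(S)+1}{\operatorname{m}(S)}\right\rceil=\left\lfloor\frac{\operatorname{F}(S)}{\operatorname{m}(S)}\right\rfloor+1$. For numerical semigroups $S,T$, $T$ is an arithmetic extension of $S$ if there exist positive integers $d_1,\dots,d_n$ ($n\ge 1$) such that $T=\{x\in\mathbb{N}\mid \{d_1x,\dots,d_nx\}\subset S\}$. An arithmetic variety is a non-empty family $\mathscr{A}$ of numerical semigroups such that (a) if $S,T\in\mathscr{A}$ then $S\cap T\in\mathscr{A}$; (b) if $S\in\mathscr{A}$ and $T$ is an arithmetic extension of $S$, then $T\in\mathscr{A}$. *)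

theory Defs
  imports Main
begin

definition numerical_semigroup :: "nat set \<Rightarrow> bool" where
  "numerical_semigroup S \<longleftrightarrow>
     0 \<in> S \<and> (\<forall>x\<in>S. \<forall>y\<in>S. x + y \<in> S) \<and> finite (- S)"

definition multiplicity :: "nat set \<Rightarrow> nat" where
  "multiplicity S = (LEAST x. x \<in> S - {0})"

(* The complement is taken in the integers, so the full semigroup has Frobenius number -1.
   That complement is infinite (all negative integers), which rules out Max. *)
definition frobenius :: "nat set \<Rightarrow> int" where
  "frobenius S = (GREATEST z. z \<notin> int ` S)"

definition depth :: "nat set \<Rightarrow> int" where
  "depth S = (THE q. \<exists>r. 0 \<le> r \<and> r < int (multiplicity S) \<and>
                frobenius S + 1 = q * int (multiplicity S) - r)"

definition arithmetic_extension :: "nat set \<Rightarrow> nat set \<Rightarrow> bool" where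
  "arithmetic_extension T S \<longleftrightarrow> numerical_semigroup T \<and> numerical_semigroup S \<and>
     (\<exists>n d. 1 \<le> n \<and> (\<forall>i\<in>{1..n}. 0 < d i) \<and>
        T = {x. (\<lambda>i::nat. d i * x) ` {1..n} \<subseteq> S})"

definition arithmetic_variety :: "nat set set \<Rightarrow> bool" where
  "arithmetic_variety A \<longleftrightarrow> A \<noteq> {} \<and> (\<forall>S\<in>A. numerical_semigroup S) \<and>
     (\<forall>S\<in>A. \<forall>T\<in>A. S \<inter> T \<in> A) \<and>
     (\<forall>S\<in>A. \<forall>T. arithmetic_extension T S \<longrightarrow> T \<in> A)"

definition depth_at_most :: "nat \<Rightarrow> nat set set" where
  "depth_at_most q = {S. numerical_semigroup S \<and> depth S \<le> int q}"

lemma multiplicity_in: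
  assumes "numerical_semigroup S"
  shows "multiplicity S \<in> S - {0}"
proof -
  have "infinite S"
    using assms finite_compl infinite_UNIV_nat unfolding numerical_semigroup_def by blast
  then have "\<exists>x. x \<in> S - {0}"
    by (metis finite.emptyI finite.insertI finite_Diff2 ex_in_conv)
  then show ?thesis
    unfolding multiplicity_def by (metis (mono_tags, lifting) LeastI_ex)
qed

lemma frobenius_greatest:
  assumes "numerical_semigroup S"
  shows "frobenius S \<notin> int ` S" and "z \<notin> int ` S \<Longrightarrow> z \<le> frobenius S"
proof -
  let ?G = "insert (-1) (int ` (- S))"
  have fin: "finite ?G"
    using assms by (simp add: numerical_semigroup_def)
  have out: "Max ?G \<notin> int ` S"
    using Max_in[OF fin] by fastforce
  have ub: "z \<le> Max ?G" if "z \<notin> int ` S" for z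
  proof (cases "z < 0")
    case True
    then have "z \<le> -1" by simp
    also have "-1 \<le> Max ?G" by (rule Max_ge[OF fin]) simp
    finally show ?thesis .
  next
    case False
    then have "z = int (nat z)" by simp
    then have "z \<in> ?G" using that by (metis ComplI image_eqI insertI2)
    then show ?thesis by (rule Max_ge[OF fin])
  qed
  have eq: "frobenius S = Max ?G"
    unfolding frobenius_def using out ub by (rule Greatest_equality)
  show "frobenius S \<notin> int ` S" using out eq by simp
  show "z \<notin> int ` S \<Longrightarrow> z \<le> frobenius S" using ub eq by simp
qed

lemma depth_eq_div:
  assumes "numerical_semigroup S"
  shows "depth S = frobenius S div int (multiplicity S) + 1"
proof -
  let ?m = "int (multiplicity S)" and ?F = "frobenius S"
  have m: "0 < ?m" using multiplicity_in[OF assms] by simp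
  show ?thesis
    unfolding depth_def
  proof (rule the_equality)
    have "?F + 1 = (?F div ?m + 1) * ?m - (?m - 1 - ?F mod ?m)"
      using div_mult_mod_eq[of ?F ?m] by (simp add: distrib_right)
    moreover have "0 \<le> ?m - 1 - ?F mod ?m" "?m - 1 - ?F mod ?m < ?m"
      using pos_mod_bound[OF m, of ?F] pos_mod_sign[OF m, of ?F] by linarith+
    ultimately show "\<exists>r. 0 \<le> r \<and> r < ?m \<and> ?F + 1 = (?F div ?m + 1) * ?m - r"
      by blast
  next
    fix q assume "\<exists>r. 0 \<le> r \<and> r < ?m \<and> ?F + 1 = q * ?m - r"
    then obtain r where r: "0 \<le> r" "r < ?m" "?F + 1 = q * ?m - r" by blast
    have "?F = ?m * (q - 1) + (?m - 1 - r)" using r(3) by (simp add: algebra_simps)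
    then have "?F div ?m = q - 1"
      using r m int_div_pos_eq[of ?F ?m "q - 1" "?m - 1 - r"] by linarith
    then show "q = ?F div ?m + 1" by simp
  qed
qed

end

theory Submission
  imports Defs
begin

text \<open>
  The proof rests on a reformulation of the depth bound that is free of division:
  \<open>depth S \<le> q\<close> says exactly that \<open>S\<close> contains every integer from \<open>q m\<close> onwards, where \<open>m\<close> is
  the multiplicity of \<open>S\<close> (lemma \<open>depth_le_iff\<close>). Both closure properties then follow from a
  comparison of multiplicities. Passing to an intersection can only raise the multiplicity, so the
  threshold of \<open>S \<inter> T\<close> lies above those of \<open>S\<close> and \<open>T\<close>. For an arithmetic extension \<open>T\<close> of \<open>S\<close>
  given by \<open>d\<^sub>1, \<dots>, d\<^sub>n\<close>, the multiplicity may drop, but only in a controlled way: each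
  \<open>d\<^sub>i m(T)\<close> is a nonzero element of \<open>S\<close>, so \<open>m(S) \<le> d\<^sub>i m(T)\<close>. Hence \<open>x \<ge> q m(T)\<close> implies
  \<open>d\<^sub>i x \<ge> q m(S)\<close>, which puts every \<open>d\<^sub>i x\<close> in \<open>S\<close>, that is, \<open>x\<close> in \<open>T\<close>.
\<close>

lemma multiplicity_le:
  assumes "x \<in> S" "0 < x"
  shows "multiplicity S \<le> x"
  unfolding multiplicity_def using assms by (intro Least_le) simp

text \<open>
  The bound \<open>\<lfloor>F / m\<rfloor> + 1 \<le> q\<close> is \<open>F < q m\<close>, and since \<open>F\<close> is the last gap, this means that no
  gap is as large as \<open>q m\<close>.
\<close>

lemma depth_le_iff:
  assumes "numerical_semigroup S"
  shows "depth S \<le> int q \<longleftrightarrow> (\<forall>x \<ge> q * multiplicity S. x \<in> S)"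
proof -
  let ?m = "int (multiplicity S)" and ?F = "frobenius S"
  have m: "0 < ?m" using multiplicity_in[OF assms] by simp
  have "depth S \<le> int q \<longleftrightarrow> ?F div ?m < int q"
    using depth_eq_div[OF assms] by linarith
  \<comment> \<open>Subtracting \<open>q m\<close> from \<open>F\<close> reduces this to the sign of a quotient by the positive \<open>m\<close>.\<close>
  also have "\<dots> \<longleftrightarrow> ?F < int q * ?m"
    using pos_imp_zdiv_neg_iff[OF m, of "?F - int q * ?m"]
      div_mult_self1[of ?m ?F "- int q"] m by simp
  also have "\<dots> \<longleftrightarrow> (\<forall>x \<ge> q * multiplicity S. x \<in> S)"
  proof
    assume less: "?F < int q * ?m"
    show "\<forall>x \<ge> q * multiplicity S. x \<in> S"
    proof (intro allI impI)
      fix x assume "q * multiplicity S \<le> x"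
      then have "int q * ?m \<le> int x" by (metis of_nat_le_iff of_nat_mult)
      then have "\<not> int x \<le> ?F" using less by linarith
      then have "int x \<in> int ` S" using frobenius_greatest(2)[OF assms] by blast
      then show "x \<in> S" by auto
    qed
  next
    assume above: "\<forall>x \<ge> q * multiplicity S. x \<in> S"
    show "?F < int q * ?m"
    proof (rule ccontr)
      assume "\<not> ?F < int q * ?m"
      then have ge: "int (q * multiplicity S) \<le> ?F" by simp
      then have "q * multiplicity S \<le> nat ?F" by linarith
      then have "nat ?F \<in> S" using above by blast
      moreover have "?F = int (nat ?F)" using ge by linarith
      ultimately show False using frobenius_greatest(1)[OF assms] by (metis imageI)
    qed
  qed
  finally show ?thesis .
qed

lemma numerical_semigroup_Int:
  assumes "numerical_semigroup S" "numerical_semigroup T"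
  shows "numerical_semigroup (S \<inter> T)"
  using assms by (auto simp: numerical_semigroup_def)

lemma depth_Int_le:
  assumes S: "numerical_semigroup S" "depth S \<le> int q"
    and T: "numerical_semigroup T" "depth T \<le> int q"
  shows "depth (S \<inter> T) \<le> int q"
proof -
  note ST = numerical_semigroup_Int[OF S(1) T(1)]
  have "multiplicity S \<le> multiplicity (S \<inter> T)" "multiplicity T \<le> multiplicity (S \<inter> T)"
    using multiplicity_in[OF ST] by (auto intro: multiplicity_le)
  then have le: "q * multiplicity S \<le> q * multiplicity (S \<inter> T)"
    "q * multiplicity T \<le> q * multiplicity (S \<inter> T)"
    by simp_all
  have "x \<in> S \<inter> T" if x: "q * multiplicity (S \<inter> T) \<le> x" for x
  proof
    show "x \<in> S" using S(2) le_trans[OF le(1) x] by (simp add: depth_le_iff[OF S(1)])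
    show "x \<in> T" using T(2) le_trans[OF le(2) x] by (simp add: depth_le_iff[OF T(1)])
  qed
  then show ?thesis by (simp add: depth_le_iff[OF ST])
qed

text \<open>
  Multiplication by \<open>d\<^sub>i\<close> scales the threshold \<open>q m(T)\<close> to \<open>q (d\<^sub>i m(T))\<close>, and positivity of \<open>d\<^sub>i\<close>
  keeps \<open>d\<^sub>i m(T)\<close> nonzero, so that it competes for the multiplicity of \<open>S\<close>.
\<close>

lemma depth_arithmetic_extension_le:
  assumes ext: "arithmetic_extension T S" and le: "depth S \<le> int q"
  shows "depth T \<le> int q"
proof -
  have S: "numerical_semigroup S" and T: "numerical_semigroup T"
    using ext by (auto simp: arithmetic_extension_def)
  obtain n :: nat and d :: "nat \<Rightarrow> nat" where d: "\<And>i. i \<in> {1..n} \<Longrightarrow> 0 < d i"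
    and T_eq: "T = {x. (\<lambda>i. d i * x) ` {1..n} \<subseteq> S}"
    using ext unfolding arithmetic_extension_def by blast
  have mem_T: "x \<in> T \<longleftrightarrow> (\<forall>i \<in> {1..n}. d i * x \<in> S)" for x
    by (subst T_eq) blast
  have "d i * x \<in> S" if x: "q * multiplicity T \<le> x" and i: "i \<in> {1..n}" for x i
  proof -
    have "d i * multiplicity T \<in> S" "0 < d i * multiplicity T"
      using multiplicity_in[OF T] d[OF i] i mem_T[of "multiplicity T"] by simp_all
    then have "multiplicity S \<le> d i * multiplicity T" by (rule multiplicity_le)
    then have "q * multiplicity S \<le> q * (d i * multiplicity T)" by simp
    also have "\<dots> \<le> d i * x" using mult_le_mono2[OF x, of "d i"] by (simp add: ac_simps)
    finally show ?thesis using le by (simp add: depth_le_iff[OF S])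
  qed
  then show ?thesis by (simp add: depth_le_iff[OF T] mem_T)
qed

theorem theorem39:
  fixes q :: nat
  shows "arithmetic_variety (depth_at_most q)"
proof -
  have "numerical_semigroup UNIV" by (simp add: numerical_semigroup_def)
  then have "UNIV \<in> depth_at_most q" by (simp add: depth_at_most_def depth_le_iff)
  moreover have "T \<in> depth_at_most q"
    if "S \<in> depth_at_most q" "arithmetic_extension T S" for S T
  proof -
    have "numerical_semigroup T"
      using that(2) unfolding arithmetic_extension_def by blast
    then show ?thesis
      using that depth_arithmetic_extension_le[OF that(2)] by (simp add: depth_at_most_def)
  qed
  moreover have "S \<inter> T \<in> depth_at_most q"
    if "S \<in> depth_at_most q" "T \<in> depth_at_most q" for S T
    using that by (simp add: depth_at_most_def numerical_semigroup_Int depth_Int_le)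
  moreover have "numerical_semigroup S" if "S \<in> depth_at_most q" for S
    using that by (simp add: depth_at_most_def)
  ultimately show ?thesis
    unfolding arithmetic_variety_def
    by blast
qed

end
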